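(* Let $a,b,c,c_1,c_2\in\mathbb{R}$ with $ac_1+bc_2\neq0$ and $b\neq0$, and let $H(s)$ be a continuous function on an interval in $(0,\infty)$ containing $s_0$. Then there exists a 2-parameter family of parabolic revolution surfaces of i-type in $\mathbb{I}^3$ with $H$ as the mean curvature (i.e. the mean curvature at the point with parameters $(s,t)$ is $H(s)$) and whose generating curves $\alpha_{h_0,h_1}(s)=(s,0,z(s))$, $s>0$ arc-length parameter, satisfy $$z(s)=h_0+h_1s+\frac{ac_1-bc_2}{2(a^2+b^2)}\,s^2+\frac{2b^2}{a^2+b^2}\int_{s_0}^{s}\int_{s_0}^{v}H(w)\,dw\,dv,$$ where $h_0,h_1$ are constants depending on the values of $z,z'$ at $s=s_0$.
   Context: The simply isotropic space $\mathbb{I}^3$ is $\mathbb{R}^3$ with the degenerate metric $\langle u,v\rangle_z=u^1v^1+u^2v^2$. For a $C^2$ parameterized surface $\mathbf{x}(u^1,u^2)=(x^1,x^2,x^3)$ write $\mathbf{x}_i=\partial\mathbf{x}/\partial u^i$, $\mathbf{x}_{ij}=\partial^2\mathbf{x}/\partial u^i\partial u^j$, $x^i_k=\partial x^i/\partial u^k$, $X_{ij}=x^i_1x^j_2-x^j_1x^i_2$. The surface is admissible if $X_{12}\neq0$ (equivalently, the induced metric has rank 2). Put $g_{ij}=\langle\mathbf{x}_i,\mathbf{x}_j\rangle_z$, $N_h=\left(\frac{X_{23}}{X_{12}},\frac{X_{31}}{X_{12}},1\right)$, $h_{ij}=\langle N_h,\mathbf{x}_{ij}\rangle$ (Euclidean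 inner product). The Gaussian and mean curvatures are $$K=\frac{h_{11}h_{22}-h_{12}^2}{g_{11}g_{22}-g_{12}^2},\qquad H=\frac12\,\frac{g_{11}h_{22}-2g_{12}h_{12}+g_{22}h_{11}}{g_{11}g_{22}-g_{12}^2};$$ equivalently $K=\det L$, $H=\frac12\mathrm{tr}\,L$ with $L=-D\xi$, $\xi=\left(A,B,\frac12(1-A^2-B^2)\right)$, $A=X_{23}/X_{12}$, $B=X_{31}/X_{12}$. The parabolic revolution surface of i-type with generating curve $\alpha(u)=(x(u),0,z(u))$ (a $C^2$ curve) and parameters $a,b,c,c_1,c_2$, where $ac_1+bc_2\neq0$, is $$Z_3(u,t)=\left(at+x(u),\ bt,\ ct+\tfrac{ac_1+bc_2}{2}t^2+c_1t\,x(u)+z(u)\right),$$ with coordinates $(u^1,u^2)=(u,t)$. It is admissible when $b\,x'\neq0$; surfaces are assumed admissible. *)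

theory Defs
  imports "HOL-Analysis.Analysis"
begin

text \<open>
  Domains need not be open, so derivatives are taken within the domain: at an endpoint of an
  interval they are one-sided, and in the interior they are the ordinary ones.
\<close>

definition C2_curve_on :: "real set \<Rightarrow> (real \<Rightarrow> 'a::real_normed_vector) \<Rightarrow> bool" where
  "C2_curve_on I f \<longleftrightarrow>
     (let f' = (\<lambda>s. vector_derivative f (at s within I));
          f'' = (\<lambda>s. vector_derivative f' (at s within I))
      in f differentiable_on I \<and> f' differentiable_on I \<and> continuous_on I f'')"

definition partial1 ::
  "(real \<times> real) set \<Rightarrow> (real \<times> real \<Rightarrow> 'a::real_normed_vector) \<Rightarrow> real \<times> real \<Rightarrow> 'a" where
  "partial1 D X = (\<lambda>(u, t). vector_derivative (\<lambda>u'. X (u', t)) (at u within {u'. (u', t) \<in> D}))"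

definition partial2 ::
  "(real \<times> real) set \<Rightarrow> (real \<times> real \<Rightarrow> 'a::real_normed_vector) \<Rightarrow> real \<times> real \<Rightarrow> 'a" where
  "partial2 D X = (\<lambda>(u, t). vector_derivative (\<lambda>t'. X (u, t')) (at t within {t'. (u, t') \<in> D}))"

definition has_partials_on ::
  "(real \<times> real) set \<Rightarrow> (real \<times> real \<Rightarrow> 'a::real_normed_vector) \<Rightarrow> bool" where
  "has_partials_on D X \<longleftrightarrow>
     (\<forall>(u, t)\<in>D. (\<lambda>u'. X (u', t)) differentiable (at u within {u'. (u', t) \<in> D}) \<and>
                 (\<lambda>t'. X (u, t')) differentiable (at t within {t'. (u, t') \<in> D}))"

primrec Ck_surface_on ::
  "nat \<Rightarrow> (real \<times> real) set \<Rightarrow> (real \<times> real \<Rightarrow> 'a::real_normed_vector) \<Rightarrow> bool" where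
  "Ck_surface_on 0 D X \<longleftrightarrow> continuous_on D X"
| "Ck_surface_on (Suc k) D X \<longleftrightarrow>
     continuous_on D X \<and> has_partials_on D X \<and>
     Ck_surface_on k D (partial1 D X) \<and> Ck_surface_on k D (partial2 D X)"

definition isotropic_inner :: "real^3 \<Rightarrow> real^3 \<Rightarrow> real" where
  "isotropic_inner u v = u$1 * v$1 + u$2 * v$2"

definition arc_length_param_on :: "real set \<Rightarrow> (real \<Rightarrow> real^3) \<Rightarrow> bool" where
  "arc_length_param_on I \<alpha> \<longleftrightarrow>
     (\<forall>s\<in>I. let v = vector_derivative \<alpha> (at s within I) in isotropic_inner v v = 1)"

definition tangent_minor ::
  "(real \<times> real) set \<Rightarrow> (real \<times> real \<Rightarrow> real^3) \<Rightarrow> 3 \<Rightarrow> 3 \<Rightarrow> real \<times> real \<Rightarrow> real" where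
  "tangent_minor D X i j p =
     partial1 D X p $ i * partial2 D X p $ j - partial1 D X p $ j * partial2 D X p $ i"

definition admissible_on :: "(real \<times> real) set \<Rightarrow> (real \<times> real \<Rightarrow> real^3) \<Rightarrow> bool" where
  "admissible_on D X \<longleftrightarrow> (\<forall>p\<in>D. tangent_minor D X 1 2 p \<noteq> 0)"

definition isotropic_normal ::
  "(real \<times> real) set \<Rightarrow> (real \<times> real \<Rightarrow> real^3) \<Rightarrow> real \<times> real \<Rightarrow> real^3" where
  "isotropic_normal D X p =
     vector [tangent_minor D X 2 3 p / tangent_minor D X 1 2 p,
             tangent_minor D X 3 1 p / tangent_minor D X 1 2 p, 1]"

definition mean_curvature ::
  "(real \<times> real) set \<Rightarrow> (real \<times> real \<Rightarrow> real^3) \<Rightarrow> real \<times> real \<Rightarrow> real" where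
  "mean_curvature D X p =
     (let g11 = isotropic_inner (partial1 D X p) (partial1 D X p);
          g12 = isotropic_inner (partial1 D X p) (partial2 D X p);
          g22 = isotropic_inner (partial2 D X p) (partial2 D X p);
          h11 = isotropic_normal D X p \<bullet> partial1 D (partial1 D X) p;
          h12 = isotropic_normal D X p \<bullet> partial1 D (partial2 D X) p;
          h22 = isotropic_normal D X p \<bullet> partial2 D (partial2 D X) p
      in 1/2 * ((g11 * h22 - 2 * g12 * h12 + g22 * h11) / (g11 * g22 - g12\<^sup>2)))"

definition generating_curve :: "(real \<Rightarrow> real) \<Rightarrow> (real \<Rightarrow> real) \<Rightarrow> real \<Rightarrow> real^3" where
  "generating_curve x z u = vector [x u, 0, z u]"

definition parabolic_revolution_surface ::
  "real \<Rightarrow> real \<Rightarrow> real \<Rightarrow> real \<Rightarrow> real \<Rightarrow> (real \<Rightarrow> real) \<Rightarrow> (real \<Rightarrow> real) \<Rightarrow> real \<times> real \<Rightarrow> real^3" where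
  "parabolic_revolution_surface a b c c1 c2 x z = (\<lambda>(u, t).
     vector [a * t + x u, b * t,
             c * t + (a * c1 + b * c2) / 2 * t\<^sup>2 + c1 * t * x u + z u])"

end

theory Submission
  imports Defs
begin

text \<open>
  Along a parabolic revolution surface generated by \<open>s \<mapsto> (s, 0, z s)\<close>, everything that enters
  the mean curvature is constant except \<open>z''\<close>: the second derivatives of the patch are vertical,
  namely \<open>(0, 0, z'')\<close>, \<open>(0, 0, c1)\<close> and \<open>(0, 0, a c1 + b c2)\<close>, the isotropic normal has third
  component \<open>1\<close>, and the degenerate metric does not see the third component of the tangent vectors
  \<open>(1, 0, _)\<close> and \<open>(a, b, _)\<close>.  Hence (\<open>mean_curvature_parabolic\<close>)
  \[ H = \frac{(a c_1 + b c_2) - 2 a c_1 + (a^2 + b^2) z''}{2 b^2}, \]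
  which depends on \<open>s\<close> alone and is solved for \<open>z''\<close> as
  \[ z'' = \frac{a c_1 - b c_2}{a^2 + b^2} + \frac{2 b^2}{a^2 + b^2} H. \]
  Two integrations give the asserted family, \<open>h0\<close> and \<open>h1\<close> being the constants of integration.
  Since \<open>s0\<close> may be an endpoint of the interval and \<open>H\<close> is only continuous there one-sidedly, the
  fundamental theorem of calculus is used in the form relative to the interval
  (\<open>interval_integral_has_real_derivative_within\<close>), and all derivatives are one-sided at endpoints.
\<close>

section \<open>Calculus on an interval that may contain its endpoints\<close>

lemma at_within_interval_neq_bot:
  fixes I :: "real set"
  assumes "is_interval I" and "interior I \<noteq> {}" and "s \<in> I"
  shows "at s within I \<noteq> bot"
proof -
  have "I \<noteq> {s}"
    using assms(2) by auto
  then have "s islimpt I"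
    using assms by (intro connected_imp_perfect) (auto simp: is_interval_connected_1)
  then show ?thesis
    by (simp add: trivial_limit_within)
qed

text \<open>
  The fundamental theorem of calculus is available on compact intervals.  A compact subinterval
  that contains both points and a neighbourhood of \<open>s\<close> relative to \<open>I\<close> suffices; to get one, go
  to a point of \<open>I\<close> beyond \<open>s\<close> on each side on which \<open>I\<close> continues.
\<close>

lemma at_within_interval_eq_Icc:
  fixes I :: "real set"
  assumes "is_interval I" and "s0 \<in> I" and "s \<in> I"
  obtains l r where "{l..r} \<subseteq> I" and "s0 \<in> {l..r}" and "s \<in> {l..r}"
    and "at s within I = at s within {l..r}"
proof -
  obtain l0 where l0: "l0 \<in> I" "l0 \<le> s" "l0 = s \<longrightarrow> (\<forall>y\<in>I. s \<le> y)"
    using assms(3) by (metis linorder_not_less nle_le)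
  obtain r0 where r0: "r0 \<in> I" "s \<le> r0" "r0 = s \<longrightarrow> (\<forall>y\<in>I. y \<le> s)"
    using assms(3) by (metis nle_le)
  define l where "l = min l0 s0"
  define r where "r = max r0 s0"
  have lr: "l \<in> I" "r \<in> I"
    using l0(1) r0(1) assms(2) by (simp_all add: l_def r_def min_def max_def)
  have sub: "{l..r} \<subseteq> I"
    using assms(1) lr by (meson atLeastAtMost_iff mem_is_interval_1_I subsetI)
  \<comment> \<open>Where \<open>I\<close> stops at \<open>s\<close>, the open neighbourhood may extend past \<open>s\<close> by any amount, here \<open>1\<close>.\<close>
  define L where "L = (if l0 < s then l0 else s - 1)"
  define R where "R = (if s < r0 then r0 else s + 1)"
  have "x \<in> {l..r}" if x: "x \<in> I" "L < x" "x < R" for x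
  proof -
    have "l \<le> l0" and "r0 \<le> r"
      by (simp_all add: l_def r_def)
    moreover have "l0 \<le> x"
      using l0 x by (cases "l0 < s") (simp_all add: L_def)
    moreover have "x \<le> r0"
      using r0 x by (cases "s < r0") (simp_all add: R_def)
    ultimately show ?thesis
      by simp
  qed
  with sub have nhd: "I \<inter> {L<..<R} - {s} = {l..r} \<inter> {L<..<R} - {s}"
    by auto
  have "at s within I = at s within {l..r}"
  proof (rule at_within_nhd)
    show "s \<in> {L<..<R}"
      by (auto simp: L_def R_def)
  qed (auto simp: nhd)
  moreover have "s0 \<in> {l..r}" and "s \<in> {l..r}"
    using l0(2) r0(2) by (auto simp: l_def r_def)
  ultimately show thesis
    using sub that by blast
qed

lemma interval_integral_has_real_derivative_within:
  fixes f :: "real \<Rightarrow> real"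
  assumes "is_interval I" and "continuous_on I f" and "s0 \<in> I" and "s \<in> I"
  shows "((\<lambda>u. LBINT y=ereal s0..ereal u. f y) has_real_derivative f s) (at s within I)"
proof -
  obtain l r where lr: "{l..r} \<subseteq> I" "s0 \<in> {l..r}" "s \<in> {l..r}"
    and eq: "at s within I = at s within {l..r}"
    using at_within_interval_eq_Icc assms(1,3,4) by blast
  have "((\<lambda>u. LBINT y=ereal s0..ereal u. f y) has_vector_derivative f s) (at s within {l..r})"
    using lr continuous_on_subset[OF assms(2) lr(1)] by (intro interval_integral_FTC2) auto
  then show ?thesis
    by (simp add: eq has_real_derivative_iff_has_vector_derivative)
qed

section \<open>Vectors given by three real functions\<close>

text \<open>
  Written over the standard basis, a vector-valued map is a sum of products, to which the
  differentiation and continuity rules apply.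
\<close>

lemma vector3_eq_basis_sum:
  "(vector [x, y, z] :: real^3) =
     x *\<^sub>R vector [1, 0, 0] + y *\<^sub>R vector [0, 1, 0] + z *\<^sub>R vector [0, 0, 1]"
  by (simp add: vec_eq_iff forall_3)

lemma has_vector_derivative_vector3:
  assumes "(f has_real_derivative f') (at s within S)"
    and "(g has_real_derivative g') (at s within S)"
    and "(h has_real_derivative h') (at s within S)"
  shows "((\<lambda>s. vector [f s, g s, h s] :: real^3) has_vector_derivative vector [f', g', h'])
    (at s within S)"
proof -
  have "((\<lambda>s. k s *\<^sub>R v) has_vector_derivative k' *\<^sub>R v) (at s within S)"
    if "(k has_real_derivative k') (at s within S)" for k k' and v :: "real^3"
    using has_vector_derivative_scaleR[OF that has_vector_derivative_const] by simp
  with assms show ?thesis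
    unfolding vector3_eq_basis_sum[of "f _"] vector3_eq_basis_sum[of f']
    by (intro has_vector_derivative_add)
qed

lemma continuous_on_vector3:
  assumes "continuous_on S f" and "continuous_on S g" and "continuous_on S h"
  shows "continuous_on S (\<lambda>s. vector [f s, g s, h s] :: real^3)"
  unfolding vector3_eq_basis_sum[of "f _"] using assms by (intro continuous_intros)

section \<open>Partial derivatives and regularity within a domain\<close>

text \<open>
  A function is differentiated within the domain, so its derivative only has to be known there.
  This allows an iterated derivative to be computed from a formula valid on the domain alone.
\<close>

lemma vector_derivative_within_cong:
  assumes "s \<in> S" and "\<And>x. x \<in> S \<Longrightarrow> f x = g x"
  shows "vector_derivative f (at s within S) = vector_derivative g (at s within S)"
    and "f differentiable (at s within S) \<longleftrightarrow> g differentiable (at s within S)"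
proof -
  have *: "(f has_vector_derivative v) (at s within S)
       \<longleftrightarrow> (g has_vector_derivative v) (at s within S)" for v
    using assms by (metis has_vector_derivative_transform)
  then show "vector_derivative f (at s within S) = vector_derivative g (at s within S)"
    by (simp add: vector_derivative_def)
  from * show "f differentiable (at s within S) \<longleftrightarrow> g differentiable (at s within S)"
    by (metis differentiableI_vector vector_derivative_works)
qed

lemma C2_curve_onI:
  assumes nontrivial: "\<And>s. s \<in> I \<Longrightarrow> at s within I \<noteq> bot"
    and f: "\<And>s. s \<in> I \<Longrightarrow> (f has_vector_derivative f' s) (at s within I)"
    and f': "\<And>s. s \<in> I \<Longrightarrow> (f' has_vector_derivative f'' s) (at s within I)"
    and f'': "continuous_on I f''"
  shows "C2_curve_on I f"
proof -
  let ?D = "\<lambda>g s. vector_derivative g (at s within I)"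
  have Df: "?D f s = f' s" if "s \<in> I" for s
    using that nontrivial f by (simp add: vector_derivative_within)
  have DDf: "(?D f has_vector_derivative f'' s) (at s within I)" if "s \<in> I" for s
    using that Df f'[OF that] by (rule has_vector_derivative_transform)
  have "?D (?D f) s = f'' s" if "s \<in> I" for s
    using nontrivial[OF that] DDf[OF that] by (rule vector_derivative_within)
  then have "continuous_on I (?D (?D f))"
    using f'' by (simp cong: continuous_on_cong)
  then show ?thesis
    unfolding C2_curve_on_def Let_def differentiable_on_def
    using f DDf by (blast intro: differentiableI_vector)
qed

lemma partial_cong:
  assumes "\<And>q. q \<in> D \<Longrightarrow> X q = Y q" and "p \<in> D"
  shows "partial1 D X p = partial1 D Y p" and "partial2 D X p = partial2 D Y p"
  unfolding partial1_def partial2_def using assms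
  by (auto split: prod.split intro!: vector_derivative_within_cong)

lemma has_partials_on_cong:
  assumes "\<And>q. q \<in> D \<Longrightarrow> X q = Y q"
  shows "has_partials_on D X \<longleftrightarrow> has_partials_on D Y"
  unfolding has_partials_on_def
proof (intro ball_cong refl, clarify)
  fix u t
  assume "(u, t) \<in> D"
  then show "(\<lambda>u'. X (u', t)) differentiable at u within {u'. (u', t) \<in> D} \<and>
      (\<lambda>t'. X (u, t')) differentiable at t within {t'. (u, t') \<in> D} \<longleftrightarrow>
      (\<lambda>u'. Y (u', t)) differentiable at u within {u'. (u', t) \<in> D} \<and>
      (\<lambda>t'. Y (u, t')) differentiable at t within {t'. (u, t') \<in> D}"
    using assms by (intro conj_cong vector_derivative_within_cong(2)) auto
qed

lemma Ck_surface_on_cong: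
  assumes "\<And>q. q \<in> D \<Longrightarrow> X q = Y q"
  shows "Ck_surface_on k D X \<longleftrightarrow> Ck_surface_on k D Y"
  using assms
proof (induction k arbitrary: X Y)
  case 0
  then show ?case
    by (simp cong: continuous_on_cong)
next
  case (Suc k)
  have "continuous_on D X \<longleftrightarrow> continuous_on D Y"
    using Suc.prems by (simp cong: continuous_on_cong)
  moreover have "has_partials_on D X \<longleftrightarrow> has_partials_on D Y"
    using Suc.prems by (rule has_partials_on_cong)
  moreover have "Ck_surface_on k D (partial1 D X) \<longleftrightarrow> Ck_surface_on k D (partial1 D Y)"
    "Ck_surface_on k D (partial2 D X) \<longleftrightarrow> Ck_surface_on k D (partial2 D Y)"
    using Suc.prems by (auto intro!: Suc.IH partial_cong)
  ultimately show ?case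
    by simp
qed

text \<open>
  The slices of \<open>I \<times> UNIV\<close> are \<open>I\<close> and the whole line, so only the first partial derivative is
  possibly one-sided; it is unique because no point of \<open>I\<close> is isolated.
\<close>

lemma partial1_strip_eq:
  assumes "at u within I \<noteq> bot" and "((\<lambda>u'. X (u', t)) has_vector_derivative v) (at u within I)"
  shows "partial1 (I \<times> UNIV) X (u, t) = v"
  using assms by (simp add: partial1_def vector_derivative_within)

lemma partial2_strip_eq:
  assumes "u \<in> I" and "((\<lambda>t'. X (u, t')) has_vector_derivative v) (at t)"
  shows "partial2 (I \<times> UNIV) X (u, t) = v"
  using assms by (simp add: partial2_def vector_derivative_at)

text \<open>
  Regularity is defined through the operators \<open>partial1\<close> and \<open>partial2\<close>, whose values off the domain
  are arbitrary; this rule replaces them by any explicit formulas \<open>A\<close> and \<open>B\<close> that agree with them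
  on the strip.
\<close>

lemma Ck_surface_on_strip_SucI:
  assumes nontrivial: "\<And>u. u \<in> I \<Longrightarrow> at u within I \<noteq> bot"
    and X: "continuous_on (I \<times> UNIV) X"
    and A: "\<And>u t. u \<in> I \<Longrightarrow> ((\<lambda>u'. X (u', t)) has_vector_derivative A (u, t)) (at u within I)"
    and B: "\<And>u t. u \<in> I \<Longrightarrow> ((\<lambda>t'. X (u, t')) has_vector_derivative B (u, t)) (at t)"
    and Ck: "Ck_surface_on k (I \<times> UNIV) A" "Ck_surface_on k (I \<times> UNIV) B"
  shows "Ck_surface_on (Suc k) (I \<times> UNIV) X"
proof -
  have "has_partials_on (I \<times> UNIV) X"
    using A[THEN differentiableI_vector] B[THEN differentiableI_vector]
    by (auto simp: has_partials_on_def)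
  moreover have "Ck_surface_on k (I \<times> UNIV) (partial1 (I \<times> UNIV) X)"
    using Ck(1) A nontrivial
    by (subst Ck_surface_on_cong[of _ _ A]) (auto intro: partial1_strip_eq)
  moreover have "Ck_surface_on k (I \<times> UNIV) (partial2 (I \<times> UNIV) X)"
    using Ck(2) B by (subst Ck_surface_on_cong[of _ _ B]) (auto intro: partial2_strip_eq)
  ultimately show ?thesis
    using X by simp
qed

section \<open>Parabolic revolution surfaces over the first coordinate\<close>

text \<open>
  A curve in the \<open>xz\<close>-plane parameterized by isotropic arc length is, up to translation and
  orientation, \<open>s \<mapsto> (s, 0, z s)\<close>: the metric ignores the height.  Here \<open>z1\<close> and \<open>z2\<close> are the first
  and second derivative of \<open>z\<close>.
\<close>

context
  fixes I :: "real set" and z z1 z2 :: "real \<Rightarrow> real"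
  assumes nontrivial: "\<And>s. s \<in> I \<Longrightarrow> at s within I \<noteq> bot"
    and z: "\<And>s. s \<in> I \<Longrightarrow> (z has_real_derivative z1 s) (at s within I)"
    and z1: "\<And>s. s \<in> I \<Longrightarrow> (z1 has_real_derivative z2 s) (at s within I)"
begin

lemma generating_curve_has_vector_derivative:
  assumes "s \<in> I"
  shows "(generating_curve (\<lambda>s. s) z has_vector_derivative vector [1, 0, z1 s]) (at s within I)"
  unfolding generating_curve_def
  using z[OF assms] by (intro has_vector_derivative_vector3) (auto intro!: derivative_eq_intros)

lemma C2_generating_curve:
  assumes "continuous_on I z2"
  shows "C2_curve_on I (generating_curve (\<lambda>s. s) z)"
proof (rule C2_curve_onI[where f'' = "\<lambda>s. vector [0, 0, z2 s]"])
  show "((\<lambda>s. vector [1, 0, z1 s] :: real^3) has_vector_derivative vector [0, 0, z2 s])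
      (at s within I)"
    if "s \<in> I" for s
    using z1[OF that] by (intro has_vector_derivative_vector3) (auto intro!: derivative_eq_intros)
  show "continuous_on I (\<lambda>s. vector [0, 0, z2 s] :: real^3)"
    using assms by (intro continuous_on_vector3 continuous_intros)
qed (simp_all add: nontrivial generating_curve_has_vector_derivative)

lemma arc_length_generating_curve:
  "arc_length_param_on I (generating_curve (\<lambda>s. s) z)"
  using vector_derivative_within[OF nontrivial generating_curve_has_vector_derivative]
  by (simp add: arc_length_param_on_def isotropic_inner_def)

context
  fixes a b c c1 c2 :: real
begin

private abbreviation (input) strip where "strip \<equiv> I \<times> (UNIV :: real set)"

private abbreviation (input) patch where "patch \<equiv> parabolic_revolution_surface a b c c1 c2 (\<lambda>s. s) z"

private abbreviation (input) patch_u :: "real \<times> real \<Rightarrow> real^3" where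
  "patch_u \<equiv> \<lambda>(u, t). vector [1, 0, c1 * t + z1 u]"

private abbreviation (input) patch_t :: "real \<times> real \<Rightarrow> real^3" where
  "patch_t \<equiv> \<lambda>(u, t). vector [a, b, c + (a * c1 + b * c2) * t + c1 * u]"

lemma patch_has_u_derivative:
  assumes "u \<in> I"
  shows "((\<lambda>u'. patch (u', t)) has_vector_derivative patch_u (u, t)) (at u within I)"
  unfolding parabolic_revolution_surface_def split
  using z[OF assms] by (intro has_vector_derivative_vector3) (auto intro!: derivative_eq_intros)

lemma patch_has_t_derivative: "((\<lambda>t'. patch (u, t')) has_vector_derivative patch_t (u, t)) (at t)"
  unfolding parabolic_revolution_surface_def split
  by (intro has_vector_derivative_vector3) (auto intro!: derivative_eq_intros)

lemma patch_u_has_u_derivative: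
  assumes "u \<in> I"
  shows "((\<lambda>u'. patch_u (u', t)) has_vector_derivative vector [0, 0, z2 u]) (at u within I)"
  unfolding split
  using z1[OF assms] by (intro has_vector_derivative_vector3) (auto intro!: derivative_eq_intros)

lemma patch_u_has_t_derivative:
  "((\<lambda>t'. patch_u (u, t')) has_vector_derivative vector [0, 0, c1]) (at t)"
  unfolding split by (intro has_vector_derivative_vector3) (auto intro!: derivative_eq_intros)

lemma patch_t_has_u_derivative:
  "((\<lambda>u'. patch_t (u', t)) has_vector_derivative vector [0, 0, c1]) (at u within I)"
  unfolding split by (intro has_vector_derivative_vector3) (auto intro!: derivative_eq_intros)

lemma patch_t_has_t_derivative:
  "((\<lambda>t'. patch_t (u, t')) has_vector_derivative vector [0, 0, a * c1 + b * c2]) (at t)"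
  unfolding split by (intro has_vector_derivative_vector3) (auto intro!: derivative_eq_intros)

lemma partials_patch:
  assumes "p \<in> strip"
  shows "partial1 strip patch p = patch_u p" and "partial2 strip patch p = patch_t p"
proof -
  obtain u t where p: "p = (u, t)" and u: "u \<in> I"
    using assms by auto
  show "partial1 strip patch p = patch_u p"
    unfolding p by (intro partial1_strip_eq nontrivial patch_has_u_derivative u)
  show "partial2 strip patch p = patch_t p"
    unfolding p by (intro partial2_strip_eq patch_has_t_derivative u)
qed

lemma second_partials_patch:
  assumes "s \<in> I"
  shows "partial1 strip (partial1 strip patch) (s, t) = vector [0, 0, z2 s]"
    and "partial1 strip (partial2 strip patch) (s, t) = vector [0, 0, c1]"
    and "partial2 strip (partial2 strip patch) (s, t) = vector [0, 0, a * c1 + b * c2]"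
proof -
  have "partial1 strip (partial1 strip patch) (s, t) = partial1 strip patch_u (s, t)"
    "partial1 strip (partial2 strip patch) (s, t) = partial1 strip patch_t (s, t)"
    "partial2 strip (partial2 strip patch) (s, t) = partial2 strip patch_t (s, t)"
    by (rule partial_cong; use assms partials_patch in simp)+
  moreover have "partial1 strip patch_u (s, t) = vector [0, 0, z2 s]"
    using assms by (intro partial1_strip_eq nontrivial patch_u_has_u_derivative)
  moreover have "partial1 strip patch_t (s, t) = vector [0, 0, c1]"
    using assms by (intro partial1_strip_eq nontrivial patch_t_has_u_derivative)
  moreover have "partial2 strip patch_t (s, t) = vector [0, 0, a * c1 + b * c2]"
    using assms by (intro partial2_strip_eq patch_t_has_t_derivative)
  ultimately show "partial1 strip (partial1 strip patch) (s, t) = vector [0, 0, z2 s]"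
    and "partial1 strip (partial2 strip patch) (s, t) = vector [0, 0, c1]"
    and "partial2 strip (partial2 strip patch) (s, t) = vector [0, 0, a * c1 + b * c2]"
    by simp_all
qed

lemma C2_parabolic:
  assumes z2: "continuous_on I z2"
  shows "Ck_surface_on 2 strip patch"
proof -
  have cont_fst: "continuous_on strip (\<lambda>p. f (fst p))" if "continuous_on I f" for f :: "real \<Rightarrow> real"
    by (rule continuous_on_compose2[OF that]) (auto intro: continuous_intros)
  have "continuous_on I z" and "continuous_on I z1"
    using z z1 by (auto intro: DERIV_continuous_on)
  note cont = this[THEN cont_fst] z2[THEN cont_fst]
  have C0_const: "Ck_surface_on 0 strip (\<lambda>_. v)" for v :: "real^3"
    by simp
  have C0_patch_uu: "Ck_surface_on 0 strip (\<lambda>p. vector [0, 0, z2 (fst p)] :: real^3)"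
    unfolding Ck_surface_on.simps by (intro continuous_on_vector3 continuous_intros cont)
  have C0: "continuous_on strip patch" "continuous_on strip patch_u" "continuous_on strip patch_t"
    unfolding parabolic_revolution_surface_def case_prod_beta
    by (intro continuous_on_vector3 continuous_intros cont)+
  have "Ck_surface_on (Suc 0) strip patch_u"
    using patch_u_has_u_derivative
    by (intro Ck_surface_on_strip_SucI[OF nontrivial C0(2) _ patch_u_has_t_derivative
          C0_patch_uu C0_const]) simp_all
  moreover have "Ck_surface_on (Suc 0) strip patch_t"
    by (rule Ck_surface_on_strip_SucI[OF nontrivial C0(3)
          patch_t_has_u_derivative patch_t_has_t_derivative C0_const C0_const])
  ultimately have "Ck_surface_on (Suc (Suc 0)) strip patch"
    using patch_has_u_derivative patch_has_t_derivative
    by (intro Ck_surface_on_strip_SucI[OF nontrivial C0(1), where A = patch_u and B = patch_t])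
  then show ?thesis
    by (simp only: numeral_2_eq_2)
qed

lemma admissible_parabolic:
  assumes "b \<noteq> 0"
  shows "admissible_on strip patch"
  using assms by (auto simp: admissible_on_def tangent_minor_def partials_patch)

text \<open>
  The second derivatives are vertical, so only the third component of the normal, which is
  \<open>1\<close>, enters the second fundamental form: its coefficients are \<open>z2 s\<close>, \<open>c1\<close> and \<open>a c1 + b c2\<close>.
  The metric coefficients are \<open>1\<close>, \<open>a\<close> and \<open>a\<^sup>2 + b\<^sup>2\<close>, with determinant \<open>b\<^sup>2\<close>.
\<close>

lemma mean_curvature_parabolic:
  assumes "s \<in> I"
  shows "mean_curvature strip patch (s, t)
    = ((a * c1 + b * c2) - 2 * a * c1 + (a\<^sup>2 + b\<^sup>2) * z2 s) / (2 * b\<^sup>2)"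
proof -
  have vertical: "isotropic_normal strip patch p \<bullet> vector [0, 0, h] = h" for p h
    by (simp add: isotropic_normal_def inner_vec_def sum_3)
  have "mean_curvature strip patch (s, t)
      = 1/2 * ((1 * (a * c1 + b * c2) - 2 * a * c1 + (a\<^sup>2 + b\<^sup>2) * z2 s)
          / (1 * (a\<^sup>2 + b\<^sup>2) - a\<^sup>2))"
    unfolding mean_curvature_def Let_def second_partials_patch[OF assms] vertical
    using assms by (simp add: partials_patch isotropic_inner_def power2_eq_square)
  then show ?thesis
    by simp
qed

end

end

section \<open>The family with prescribed mean curvature\<close>

theorem theorem5p7:
  fixes a b c c1 c2 s0 :: real and I :: "real set" and H :: "real \<Rightarrow> real"
  assumes "a * c1 + b * c2 \<noteq> 0" and "b \<noteq> 0"
    and "is_interval I" and "interior I \<noteq> {}" and "I \<subseteq> {0<..}" and "s0 \<in> I"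
    and "continuous_on I H"
  shows "\<exists>z :: real \<Rightarrow> real \<Rightarrow> real \<Rightarrow> real.
    (\<forall>h0 h1.
       (\<forall>s\<in>I. z h0 h1 s =
          h0 + h1 * s + (a * c1 - b * c2) / (2 * (a\<^sup>2 + b\<^sup>2)) * s\<^sup>2
          + 2 * b\<^sup>2 / (a\<^sup>2 + b\<^sup>2) * (LBINT v=ereal s0..ereal s. (LBINT w=ereal s0..ereal v. H w))) \<and>
       C2_curve_on I (generating_curve (\<lambda>s. s) (z h0 h1)) \<and>
       arc_length_param_on I (generating_curve (\<lambda>s. s) (z h0 h1)) \<and>
       (let Z = parabolic_revolution_surface a b c c1 c2 (\<lambda>s. s) (z h0 h1); D = I \<times> UNIV in
          Ck_surface_on 2 D Z \<and> admissible_on D Z \<and>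
          (\<forall>s\<in>I. \<forall>t. mean_curvature D Z (s, t) = H s))) \<and>
    (\<forall>p q. \<exists>!(h0, h1).
       z h0 h1 s0 = p \<and> (z h0 h1 has_real_derivative q) (at s0 within I))"
proof -
  define k where "k = (a * c1 - b * c2) / (2 * (a\<^sup>2 + b\<^sup>2))"
  define m where "m = 2 * b\<^sup>2 / (a\<^sup>2 + b\<^sup>2)"
  define F where "F = (\<lambda>v. LBINT w=ereal s0..ereal v. H w)"
  define G where "G = (\<lambda>s. LBINT v=ereal s0..ereal s. F v)"
  define z where "z = (\<lambda>h0 h1 s. h0 + h1 * s + k * s\<^sup>2 + m * G s)"
  define z1 where "z1 = (\<lambda>h1 s. h1 + 2 * k * s + m * F s)"
  define z2 where "z2 = (\<lambda>s. 2 * k + m * H s)"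
  have nontrivial: "at s within I \<noteq> bot" if "s \<in> I" for s
    using at_within_interval_neq_bot assms(3,4) that .
  have F: "(F has_real_derivative H s) (at s within I)" if "s \<in> I" for s
    unfolding F_def
    using assms(3,7,6) that by (rule interval_integral_has_real_derivative_within)
  then have "continuous_on I F"
    by (rule DERIV_continuous_on)
  then have G: "(G has_real_derivative F s) (at s within I)" if "s \<in> I" for s
    unfolding G_def
    using that assms(3,6) by (blast intro: interval_integral_has_real_derivative_within)
  have z: "(z h0 h1 has_real_derivative z1 h1 s) (at s within I)" if "s \<in> I" for h0 h1 s
    unfolding z_def z1_def using G[OF that] by (auto intro!: derivative_eq_intros)
  have z1: "(z1 h1 has_real_derivative z2 s) (at s within I)" if "s \<in> I" for h1 s
    unfolding z1_def z2_def using F[OF that] by (auto intro!: derivative_eq_intros)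
  have z2: "continuous_on I z2"
    unfolding z2_def using assms(7) by (intro continuous_intros)
  have "a\<^sup>2 + b\<^sup>2 \<noteq> 0"
    using assms(2) by (simp add: sum_power2_eq_zero_iff)
  \<comment> \<open>The constants \<open>k\<close> and \<open>m\<close> are those that solve the curvature equation for \<open>z''\<close>.\<close>
  have scaled: "d * (2 * (x / (2 * d))) = x" "d * (x / d) = x" if "d \<noteq> 0" for d x :: real
    using that by simp_all
  have "(a\<^sup>2 + b\<^sup>2) * (2 * k) = a * c1 - b * c2" and "(a\<^sup>2 + b\<^sup>2) * m = 2 * b\<^sup>2"
    unfolding k_def m_def using \<open>a\<^sup>2 + b\<^sup>2 \<noteq> 0\<close> by (intro scaled; assumption)+
  then have "(a\<^sup>2 + b\<^sup>2) * z2 s = a * c1 - b * c2 + 2 * b\<^sup>2 * H s" for s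
    unfolding z2_def by (simp only: distrib_left mult.assoc[symmetric])
  then have H: "((a * c1 + b * c2) - 2 * a * c1 + (a\<^sup>2 + b\<^sup>2) * z2 s) / (2 * b\<^sup>2) = H s" for s
    using assms(2) by simp
  \<comment> \<open>Both integrals vanish at \<open>s0\<close>, so the initial values determine first \<open>h1\<close> and then \<open>h0\<close>.\<close>
  have "F s0 = 0" and "G s0 = 0"
    by (simp_all add: F_def G_def)
  then have at_s0: "z h0 h1 s0 = h0 + h1 * s0 + k * s0\<^sup>2" "z1 h1 s0 = h1 + 2 * k * s0" for h0 h1
    by (simp_all add: z_def z1_def)
  have deriv_iff: "(z h0 h1 has_real_derivative q) (at s0 within I) \<longleftrightarrow> q = z1 h1 s0" for h0 h1 q
    using z[OF assms(6)] nontrivial[OF assms(6)]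
    by (auto simp: has_real_derivative_iff_has_vector_derivative
        dest: vector_derivative_unique_within)
  have unique: "\<exists>!(h0, h1). z h0 h1 s0 = p \<and> (z h0 h1 has_real_derivative q) (at s0 within I)"
    for p q
    unfolding deriv_iff at_s0
    by (rule ex1I[of _ "(p - (q - 2 * k * s0) * s0 - k * s0\<^sup>2, q - 2 * k * s0)"]) auto
  have formula: "z h0 h1 s =
      h0 + h1 * s + (a * c1 - b * c2) / (2 * (a\<^sup>2 + b\<^sup>2)) * s\<^sup>2
      + 2 * b\<^sup>2 / (a\<^sup>2 + b\<^sup>2) * (LBINT v=ereal s0..ereal s. (LBINT w=ereal s0..ereal v. H w))"
    for h0 h1 s
    by (simp only: z_def k_def m_def G_def F_def)
  show ?thesis
    unfolding Let_def
  proof (intro exI[of _ z] conjI allI ballI)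
    fix h0 h1 s t
    show "C2_curve_on I (generating_curve (\<lambda>s. s) (z h0 h1))"
      by (rule C2_generating_curve[OF nontrivial z z1 z2])
    show "arc_length_param_on I (generating_curve (\<lambda>s. s) (z h0 h1))"
      by (rule arc_length_generating_curve[OF nontrivial z z1])
    show "Ck_surface_on 2 (I \<times> UNIV)
        (parabolic_revolution_surface a b c c1 c2 (\<lambda>s. s) (z h0 h1))"
      by (rule C2_parabolic[OF nontrivial z z1 z2])
    show "admissible_on (I \<times> UNIV)
        (parabolic_revolution_surface a b c c1 c2 (\<lambda>s. s) (z h0 h1))"
      by (rule admissible_parabolic[OF nontrivial z z1 assms(2)])
    show "mean_curvature (I \<times> UNIV)
        (parabolic_revolution_surface a b c c1 c2 (\<lambda>s. s) (z h0 h1)) (s, t) = H s" if "s \<in> I"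
      by (subst mean_curvature_parabolic[OF nontrivial z z1]) (assumption | rule that H)+
  qed (rule formula unique)+
qed

end
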